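(* Let $\mathbb{F}$ be a field with $\mathbb{F}\neq\mathbb{F}_2$, let $(V,Q)$ be a finite-dimensional non-degenerate quadratic space over $\mathbb{F}$, and let $f\in O(V)$ be a minimal isometry. Then $g\mapsto \mathrm{Mov}(g)$ is an order-preserving bijection between the interval $[\mathrm{id},f]$ in $O(V)$ and the poset (ordered by inclusion) of linear subspaces $U\subseteq \mathrm{Mov}(f)$ that satisfy the following conditions: (i) $U=\{0\}$ or $U$ is not totally singular; (ii) $U^{\triangleright}=\{0\}$ or $U^{\triangleright}$ is not totally singular; (iii) $\chi_f|_U$ is non-degenerate. In addition, the rank of $g\in[\mathrm{id},f]$ is equal to $\dim \mathrm{Mov}(g)$.
   Context: A quadratic form on a finite-dimensional vector space $V$ over $\mathbb{F}$ is a map $Q\colon V\to\mathbb{F}$ with $Q(av)=a^2Q(v)$ for $a\in\mathbb{F}$, $v\in V$, and such that the polar form $\beta(u,v)=Q(u+v)-Q(u)-Q(v)$ is bilinear; $(V,Q)$ is non-degenerate if $\beta$ is non-degenerate. $O(V)$ is the group of $f\in\mathrm{GL}(V)$ with $Q(f(u))=Q(u)$ for all $u$ (isometries). A vector $v$ is non-singular if $Q(v)\ne0$. A reflection is an isometry $r_v(u)=u-\frac{\beta(u,v)}{Q(v)}v$ with $v$ non-singular (equivalently, a non-trivial isometry fixing a hyperplane pointwise). A subspace $W$ is totally singular if $Q(u)=0$ for all $u\in W$. The moved space of $f\in O(V)$ is $\mathrm{Mov}(f)=\mathrm{im}(\mathrm{id}-f)$. The Wall form of $f$ is the non-degenerate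 (not necessarily symmetric) bilinear form $\chi_f$ on $\mathrm{Mov}(f)$ given by $\chi_f(u,v)=\beta(w,v)$, where $w\in V$ is any vector with $u=w-f(w)$. For $U\subseteq\mathrm{Mov}(f)$, $U^{\triangleright}=\{v\in\mathrm{Mov}(f)\mid \chi_f(u,v)=0 \text{ for all } u\in U\}$. Since $\mathbb{F}\ne\mathbb{F}_2$, every isometry is a product of reflections; $l(f)$ denotes the minimal number of reflections in such a product (reflection length, $l(\mathrm{id})=0$). The partial order on $O(V)$ is: $g\le f$ iff $l(f)=l(g)+l(g^{-1}f)$. The poset $O(V)$ is ranked by $l$ (so the rank of $g\in[\mathrm{id},f]$ is $l(g)$), and $[\mathrm{id},f]=\{h\in O(V)\mid \mathrm{id}\le h\le f\}$. An isometry $f$ is minimal if $l(f)=\dim\mathrm{Mov}(f)$ (equivalently, $f=\mathrm{id}$ or $\mathrm{Mov}(f)$ is not totally singular). *)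

theory Defs
  imports Complex_Main
begin

text \<open>
  The vector space V is a whole type \<open>'v\<close> with scalar multiplication \<open>scale\<close> over the field
  \<open>'k\<close>, of arbitrary characteristic.
\<close>

definition polar :: "('v::ab_group_add \<Rightarrow> 'k::field) \<Rightarrow> 'v \<Rightarrow> 'v \<Rightarrow> 'k" where
  "polar Q u v = Q (u + v) - Q u - Q v"

definition bilinear_form :: "('k::field \<Rightarrow> 'v::ab_group_add \<Rightarrow> 'v) \<Rightarrow> ('v \<Rightarrow> 'v \<Rightarrow> 'k) \<Rightarrow> bool" where
  "bilinear_form scale b \<longleftrightarrow>
     (\<forall>u. Vector_Spaces.linear scale (*) (\<lambda>v. b u v)) \<and>
     (\<forall>v. Vector_Spaces.linear scale (*) (\<lambda>u. b u v))"

definition quadratic_form :: "('k::field \<Rightarrow> 'v::ab_group_add \<Rightarrow> 'v) \<Rightarrow> ('v \<Rightarrow> 'k) \<Rightarrow> bool" where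
  "quadratic_form scale Q \<longleftrightarrow>
     (\<forall>a v. Q (scale a v) = a ^ 2 * Q v) \<and> bilinear_form scale (polar Q)"

text \<open>
  Both radicals are required to vanish, since the forms considered need not be symmetric.
\<close>
definition nondegenerate_on :: "'v set \<Rightarrow> ('v::ab_group_add \<Rightarrow> 'v \<Rightarrow> 'k::field) \<Rightarrow> bool" where
  "nondegenerate_on U b \<longleftrightarrow>
     (\<forall>u\<in>U. (\<forall>v\<in>U. b u v = 0) \<longrightarrow> u = 0) \<and>
     (\<forall>v\<in>U. (\<forall>u\<in>U. b u v = 0) \<longrightarrow> v = 0)"

definition totally_singular :: "('v::ab_group_add \<Rightarrow> 'k::field) \<Rightarrow> 'v set \<Rightarrow> bool" where
  "totally_singular Q W \<longleftrightarrow> (\<forall>u\<in>W. Q u = 0)"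

definition orthogonal_group ::
    "('k::field \<Rightarrow> 'v::ab_group_add \<Rightarrow> 'v) \<Rightarrow> ('v \<Rightarrow> 'k) \<Rightarrow> ('v \<Rightarrow> 'v) set" where
  "orthogonal_group scale Q =
     {f. Vector_Spaces.linear scale scale f \<and> bij f \<and> (\<forall>u. Q (f u) = Q u)}"

definition reflection ::
    "('k::field \<Rightarrow> 'v::ab_group_add \<Rightarrow> 'v) \<Rightarrow> ('v \<Rightarrow> 'k) \<Rightarrow> 'v \<Rightarrow> 'v \<Rightarrow> 'v" where
  "reflection scale Q v u = u - scale (polar Q u v / Q v) v"

text \<open>
  The least length of a factorization into reflections along non-singular vectors. It is
  meaningful only for maps having such a factorization, which every isometry of a
  finite-dimensional non-degenerate quadratic space has when the field is not \<open>F\<^sub>2\<close>.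
\<close>
definition reflection_length ::
    "('k::field \<Rightarrow> 'v::ab_group_add \<Rightarrow> 'v) \<Rightarrow> ('v \<Rightarrow> 'k) \<Rightarrow> ('v \<Rightarrow> 'v) \<Rightarrow> nat" where
  "reflection_length scale Q f =
     (LEAST n. \<exists>vs. length vs = n \<and> (\<forall>v\<in>set vs. Q v \<noteq> 0) \<and>
        f = foldr (\<circ>) (map (reflection scale Q) vs) id)"

definition isometry_le ::
    "('k::field \<Rightarrow> 'v::ab_group_add \<Rightarrow> 'v) \<Rightarrow> ('v \<Rightarrow> 'k) \<Rightarrow> ('v \<Rightarrow> 'v) \<Rightarrow> ('v \<Rightarrow> 'v) \<Rightarrow> bool" where
  "isometry_le scale Q g f \<longleftrightarrow>
     reflection_length scale Q f =
       reflection_length scale Q g + reflection_length scale Q (inv g \<circ> f)"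

definition isometry_interval ::
    "('k::field \<Rightarrow> 'v::ab_group_add \<Rightarrow> 'v) \<Rightarrow> ('v \<Rightarrow> 'k) \<Rightarrow> ('v \<Rightarrow> 'v) \<Rightarrow> ('v \<Rightarrow> 'v) set" where
  "isometry_interval scale Q f =
     {h \<in> orthogonal_group scale Q. isometry_le scale Q id h \<and> isometry_le scale Q h f}"

definition Mov :: "('v::ab_group_add \<Rightarrow> 'v) \<Rightarrow> 'v set" where
  "Mov f = range (\<lambda>v. v - f v)"

definition minimal_isometry ::
    "('k::field \<Rightarrow> 'v::ab_group_add \<Rightarrow> 'v) \<Rightarrow> ('v \<Rightarrow> 'k) \<Rightarrow> ('v \<Rightarrow> 'v) \<Rightarrow> bool" where
  "minimal_isometry scale Q f \<longleftrightarrow>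
     f \<in> orthogonal_group scale Q \<and>
     reflection_length scale Q f = vector_space.dim scale (Mov f)"

text \<open>
  The Wall form is meaningful for arguments in \<open>Mov f\<close> only. There the choice of the preimage
  \<open>w\<close> is irrelevant, as shown by \<open>wall_form_eq\<close> below.
\<close>
definition wall_form ::
    "('v::ab_group_add \<Rightarrow> 'k::field) \<Rightarrow> ('v \<Rightarrow> 'v) \<Rightarrow> 'v \<Rightarrow> 'v \<Rightarrow> 'k" where
  "wall_form Q f u v = polar Q (SOME w. u = w - f w) v"

definition wall_orth ::
    "('v::ab_group_add \<Rightarrow> 'k::field) \<Rightarrow> ('v \<Rightarrow> 'v) \<Rightarrow> 'v set \<Rightarrow> 'v set" where
  "wall_orth Q f U = {v \<in> Mov f. \<forall>u\<in>U. wall_form Q f u v = 0}"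

lemma wall_form_eq:
  fixes scale :: "'k::field \<Rightarrow> 'v::ab_group_add \<Rightarrow> 'v"
  assumes Q: "quadratic_form scale Q" and f: "f \<in> orthogonal_group scale Q"
    and u: "u = w - f w" and v: "v \<in> Mov f"
  shows "wall_form Q f u v = polar Q w v"
proof -
  have lin: "Vector_Spaces.linear scale scale f" and iso: "\<And>x. Q (f x) = Q x"
    using f by (auto simp: orthogonal_group_def)
  interpret F: Vector_Spaces.linear scale scale f by (rule lin)
  have lin1: "Vector_Spaces.linear scale (*) (\<lambda>x. polar Q x y)"
    and lin2: "Vector_Spaces.linear scale (*) (\<lambda>y. polar Q x y)" for x y
    using Q by (auto simp: quadratic_form_def bilinear_form_def)
  have diff1: "polar Q (x - x') y = polar Q x y - polar Q x' y" for x x' y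
    using module_hom.diff[OF Vector_Spaces.linear.axioms(3)[OF lin1]] .
  have diff2: "polar Q x (y - y') = polar Q x y - polar Q x y'" for x y y'
    using module_hom.diff[OF Vector_Spaces.linear.axioms(3)[OF lin2]] .
  obtain z where z: "v = z - f z" using v by (auto simp: Mov_def)
  define w' where "w' = (SOME w. u = w - f w)"
  have w': "u = w' - f w'" unfolding w'_def using u by (rule someI)
  have fixed: "f (w' - w) = w' - w" using u w' by (simp add: F.diff algebra_simps)
  have "polar Q (f x) (f y) = polar Q x y" for x y
    by (simp add: polar_def iso flip: F.add)
  then have "polar Q (w' - w) (f z) = polar Q (w' - w) z" using fixed by metis
  then have "polar Q (w' - w) v = 0" by (simp add: z diff2)
  then show ?thesis by (simp add: wall_form_def w'_def diff1)
qed

end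

theory Submission
  imports Defs
begin

text \<open>
  An isometry \<open>g\<close> is determined by \<open>Mov g\<close> and its Wall form, and every subspace \<open>U\<close> of \<open>Mov f\<close> on
  which the Wall form of \<open>f\<close> is non-degenerate arises in this way: \<open>g x = x - p x\<close>, where
  \<open>p x \<in> U\<close> represents the functional \<open>\<beta>(x, _)\<close> on \<open>U\<close> with respect to that form. Then
  \<open>g\<inverse> f\<close> has moved space \<open>wall_orth Q f U\<close>, a complement of \<open>U\<close> in \<open>Mov f\<close>. Splitting off one
  reflection at a time in this manner factors an isometry whose moved space is \<open>{0}\<close> or not
  totally singular into \<open>dim (Mov f)\<close> reflections, the least number possible because
  \<open>Mov (g h) \<subseteq> Mov g + Mov h\<close>. The same inclusion shows that, for minimal \<open>f\<close>, the relation
  \<open>g \<le> f\<close> forces \<open>g\<close> and \<open>g\<inverse> f\<close> to be minimal and \<open>Mov f\<close> to be the direct sum of their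
  moved spaces.
\<close>

section \<open>Bilinear forms on a vector space\<close>

lemma bilinear_form_simps:
  fixes scale :: "'k::field \<Rightarrow> 'v::ab_group_add \<Rightarrow> 'v"
  assumes "bilinear_form scale b"
  shows "b (x + y) z = b x z + b y z" "b z (x + y) = b z x + b z y"
    "b (x - y) z = b x z - b y z" "b z (x - y) = b z x - b z y"
    "b (scale c x) z = c * b x z" "b z (scale c x) = c * b z x"
    "b 0 z = 0" "b z 0 = 0"
proof -
  interpret L: Vector_Spaces.linear scale "(*)" "\<lambda>x. b x z"
    using assms by (simp add: bilinear_form_def)
  interpret R: Vector_Spaces.linear scale "(*)" "\<lambda>x. b z x"
    using assms by (simp add: bilinear_form_def)
  show "b (x + y) z = b x z + b y z" "b z (x + y) = b z x + b z y"
    "b (x - y) z = b x z - b y z" "b z (x - y) = b z x - b z y"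
    "b (scale c x) z = c * b x z" "b z (scale c x) = c * b z x"
    "b 0 z = 0" "b z 0 = 0"
    using L.add R.add L.diff R.diff L.scale R.scale L.zero R.zero by simp_all
qed

text \<open>\<open>card\<close> is 0 for an infinite type, so the hypothesis excludes the
  two-element field only.\<close>

lemma exists_nonzero_avoiding:
  fixes a :: "'k::field"
  assumes "card (UNIV :: 'k set) \<noteq> 2"
  shows "\<exists>c::'k. c \<noteq> 0 \<and> c \<noteq> a"
proof (cases "a = 0")
  case True
  then show ?thesis using zero_neq_one by metis
next
  case False
  then have "card {0, a} = 2" by simp
  then have "{0, a} \<noteq> UNIV" using assms by auto
  then show ?thesis by blast
qed

context vector_space
begin

text \<open>
  The step that needs more than two scalars. If the claim failed, then for every anisotropic
  \<open>v\<close> the form would be alternating and non-degenerate on the complement \<open>{u \<in> U. b v u = 0}\<close>;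
  testing this on \<open>c v + w\<close> as well forces \<open>b w v = 0\<close> and \<open>b y v \<noteq> 0\<close> whenever \<open>b w y \<noteq> 0\<close>,
  which is contradictory because \<open>w\<close> and \<open>y\<close> can be exchanged.
\<close>
lemma exists_anisotropic_with_good_complement:
  fixes b :: "'b \<Rightarrow> 'b \<Rightarrow> 'a"
  assumes card: "card (UNIV :: 'a set) \<noteq> 2"
    and b: "bilinear_form scale b" and U: "subspace U"
    and nondeg: "\<And>v. v \<in> U \<Longrightarrow> (\<And>u. u \<in> U \<Longrightarrow> b u v = 0) \<Longrightarrow> v = 0"
    and v0: "v0 \<in> U" "b v0 v0 \<noteq> 0"
  shows "\<exists>v\<in>U. b v v \<noteq> 0 \<and>
           ({u \<in> U. b v u = 0} = {0} \<or> (\<exists>u\<in>U. b v u = 0 \<and> b u u \<noteq> 0))"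
proof (rule ccontr)
  note bs = bilinear_form_simps[OF b]
  assume neg: "\<not> ?thesis"
  then have iso: "b u u = 0" if "v \<in> U" "b v v \<noteq> 0" "u \<in> U" "b v u = 0" for v u
    using that by blast
  let ?W = "{u \<in> U. b v0 u = 0}"
  have key: "b w v0 = 0 \<and> b y v0 \<noteq> 0" if w: "w \<in> ?W" and y: "y \<in> ?W" and wy: "b w y \<noteq> 0" for w y
  proof -
    \<comment> \<open>This choice makes \<open>scale c v0 + w\<close> anisotropic: its value is
      \<open>c * d\<close>, since \<open>b v0 w = 0\<close> and \<open>b w w = 0\<close>.\<close>
    obtain c where c: "c \<noteq> 0" "c \<noteq> - b w v0 / b v0 v0"
      using exists_nonzero_avoiding[OF card] by blast
    define d where "d = c * b v0 v0 + b w v0"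
    have d: "d \<noteq> 0"
    proof
      assume "d = 0"
      then have "c * b v0 v0 = - b w v0" by (simp add: d_def eq_neg_iff_add_eq_0)
      then show False using c(2) v0(2) by (metis nonzero_eq_divide_eq)
    qed
    \<comment> \<open>\<open>a * d + b w y = 0\<close>, so \<open>scale a v0 + z\<close> is right
      orthogonal to \<open>scale c v0 + w\<close> whenever \<open>z\<close> is as in
      \<open>eq\<close>.\<close>
    define a where "a = - b w y / d"
    have a: "a \<noteq> 0" "a * d = - b w y" using wy d by (simp_all add: a_def)
    have ww: "b w w = 0" using iso v0 w by blast
    have v'U: "scale c v0 + w \<in> U" using U v0 w by (simp add: subspace_add subspace_scale)
    have "b (scale c v0 + w) (scale c v0 + w) = c * d"
      using w ww by (simp add: bs d_def algebra_simps)
    then have v'Q: "b (scale c v0 + w) (scale c v0 + w) \<noteq> 0" using c d by simp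
    have eq: "a * b v0 v0 = - b z v0" if z: "z \<in> ?W" and wz: "b w z = b w y" for z
    proof -
      have "b (scale c v0 + w) (scale a v0 + z) = a * d + b w z"
        using z by (simp add: bs d_def algebra_simps)
      then have "b (scale c v0 + w) (scale a v0 + z) = 0" using wz a by simp
      moreover have "scale a v0 + z \<in> U" using U v0 z by (simp add: subspace_add subspace_scale)
      ultimately have "b (scale a v0 + z) (scale a v0 + z) = 0" using iso v'U v'Q by blast
      moreover have "b z z = 0" using iso v0 z by blast
      then have "b (scale a v0 + z) (scale a v0 + z) = a * (a * b v0 v0 + b z v0)"
        using z by (simp add: bs algebra_simps)
      ultimately show ?thesis using a by (simp add: eq_neg_iff_add_eq_0)
    qed
    have "a * b v0 v0 = - b y v0" using eq y by blast
    \<comment> \<open>Adding the isotropic \<open>w\<close> to \<open>y\<close> leaves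
      \<open>b w y\<close> unchanged, so \<open>eq\<close> holds for both vectors; comparing them
      gives \<open>b w v0 = 0\<close>.\<close>
    moreover have "a * b v0 v0 = - b (y + w) v0"
      by (rule eq) (use U y w ww in \<open>auto simp: bs subspace_add\<close>)
    ultimately show ?thesis using a v0 by (auto simp: bs)
  qed
  have "?W \<noteq> {0}" using neg v0 by blast
  moreover have "0 \<in> ?W" using U by (simp add: subspace_0 bs)
  ultimately obtain w where w: "w \<in> ?W" "w \<noteq> 0" by blast
  then obtain z where z: "z \<in> U" "b z w \<noteq> 0" using nondeg by blast
  \<comment> \<open>The component of \<open>z\<close> in \<open>?W\<close> along \<open>v0\<close>;
    since \<open>b v0 w = 0\<close>, it pairs with \<open>w\<close> as \<open>z\<close>
    does.\<close>
  define y where "y = z - scale (b v0 z / b v0 v0) v0"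
  have y: "y \<in> ?W"
    using U z v0 by (simp add: y_def bs subspace_diff subspace_scale)
  have yw: "b y w \<noteq> 0" using z w by (simp add: y_def bs)
  \<comment> \<open>Isotropy of \<open>y + w\<close> gives \<open>b w y = - b y w\<close>, so
    \<open>key\<close> applies in both orders.\<close>
  have "y + w \<in> ?W" using U y w by (simp add: bs subspace_add)
  then have "b (y + w) (y + w) = 0" "b y y = 0" "b w w = 0" using iso v0 y w by blast+
  then have "b w y \<noteq> 0" using yw by (auto simp: bs)
  then show False using key[of w y] key[of y w] w y yw by blast
qed

end

context finite_dimensional_vector_space
begin

text \<open>Taking the values of \<open>b u\<close> on a basis of \<open>U\<close> as coordinates
  gives an endomorphism \<open>T\<close> of \<open>U\<close>. Its kernel is the left radical, so
  \<open>T\<close> is injective and, by dimension, onto: any prescribed values are attained.\<close>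

lemma bilinear_form_represents:
  assumes b: "bilinear_form scale b" and U: "subspace U"
    and nondeg: "\<And>u. u \<in> U \<Longrightarrow> (\<And>v. v \<in> U \<Longrightarrow> b u v = 0) \<Longrightarrow> u = 0"
    and \<phi>: "Vector_Spaces.linear scale (*) \<phi>"
  shows "\<exists>u\<in>U. \<forall>v\<in>U. b u v = \<phi> v"
proof -
  note bs = bilinear_form_simps[OF b]
  obtain B where B: "B \<subseteq> U" "independent B" "U \<subseteq> span B"
    using basis_exists by metis
  have fin: "finite B" by (rule finiteI_independent[OF B(2)])
  define T where "T u = (\<Sum>e\<in>B. scale (b u e) e)" for u
  have lin: "Vector_Spaces.linear scale scale T"
    unfolding Vector_Spaces.linear_iff T_def
    by (auto simp: vector_space_axioms bs scale_left_distrib sum.distrib scale_sum_right)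
  interpret T: Vector_Spaces.linear scale scale T by (rule lin)
  interpret P: finite_dimensional_vector_space_pair scale Basis scale Basis by unfold_locales
  have coeffs: "b u v = \<psi> v" if "T u = (\<Sum>e\<in>B. scale (\<psi> e) e)" "v \<in> U"
    and \<psi>: "Vector_Spaces.linear scale (*) \<psi>" for u v \<psi>
  proof -
    have "(\<Sum>e\<in>B. scale (b u e - \<psi> e) e) = 0"
      using that by (simp add: T_def scale_left_diff_distrib sum_subtractf)
    then have "b u e - \<psi> e = 0" if "e \<in> B" for e
      using B(2) that by (auto simp: independent_explicit)
    moreover have "Vector_Spaces.linear scale (*) (b u)"
      using b by (simp add: bilinear_form_def)
    moreover have "vector_space_pair scale ((*) :: 'a \<Rightarrow> 'a \<Rightarrow> 'a)"
      by (unfold_locales; simp add: algebra_simps)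
    ultimately show ?thesis
      using vector_space_pair.linear_eq_on[of scale "(*)" "b u" \<psi> v B] \<psi> B that by auto
  qed
  have "Vector_Spaces.linear scale (*) (\<lambda>v. 0 :: 'a)"
    using \<phi> by (simp add: Vector_Spaces.linear_iff)
  then have "inj_on T U"
    unfolding T.inj_on_iff_eq_0[OF U] using nondeg coeffs[where \<psi> = "\<lambda>v. 0"] by simp
  then have "dim (T ` U) = dim U"
    using P.dim_image_eq[OF lin] U by (metis span_eq_iff)
  moreover have "T ` U \<subseteq> U"
    using B by (auto simp: T_def intro!: subspace_sum[OF U] subspace_scale[OF U])
  ultimately have "T ` U = U" using subspace_dim_equal T.subspace_image U by simp
  moreover have "(\<Sum>e\<in>B. scale (\<phi> e) e) \<in> U"
    using B by (auto intro!: subspace_sum[OF U] subspace_scale[OF U])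
  ultimately obtain u where "u \<in> U" "T u = (\<Sum>e\<in>B. scale (\<phi> e) e)" by (metis imageE)
  then show ?thesis using coeffs \<phi> by blast
qed

end

section \<open>Quadratic spaces and their isometries\<close>

locale quadratic_space = finite_dimensional_vector_space scale Basis
  for scale :: "'k::field \<Rightarrow> 'v::ab_group_add \<Rightarrow> 'v" and Basis :: "'v set" +
  fixes Q :: "'v \<Rightarrow> 'k"
  assumes quadratic: "quadratic_form scale Q"
    and nondegenerate: "nondegenerate_on UNIV (polar Q)"
begin

abbreviation "\<beta> \<equiv> polar Q"
abbreviation "OV \<equiv> orthogonal_group scale Q"
abbreviation "reflect \<equiv> reflection scale Q"
abbreviation "len \<equiv> reflection_length scale Q"
abbreviation "reflections_product vs \<equiv> foldr (\<circ>) (map reflect vs) id"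

lemma bilinear_polar: "bilinear_form scale \<beta>"
  using quadratic by (simp add: quadratic_form_def)

lemmas polar_simps = bilinear_form_simps[OF bilinear_polar]

lemma polar_commute: "\<beta> u v = \<beta> v u"
  by (simp add: polar_def add.commute)

lemma Q_scale: "Q (scale c v) = c\<^sup>2 * Q v"
  using quadratic by (simp add: quadratic_form_def)

lemma Q_0: "Q 0 = 0"
  using Q_scale[of 0 0] by simp

lemma Q_add: "Q (u + v) = Q u + Q v + \<beta> u v"
  by (simp add: polar_def)

lemma Q_diff: "Q (u - v) = Q u + Q v - \<beta> u v"
  using Q_add[of "u - v" v] Q_add[of v v] Q_scale[of 2 v] scale_left_distrib[of 1 1 v]
  by (simp add: polar_simps algebra_simps power2_eq_square)

lemma polar_self: "\<beta> v v = 2 * Q v"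
  using Q_diff[of v v] by (simp add: Q_0)

lemma polar_eq_0D: "(\<And>v. \<beta> u v = 0) \<Longrightarrow> u = 0"
  using nondegenerate by (simp add: nondegenerate_on_def)

lemma OVD:
  assumes "f \<in> OV"
  shows "Vector_Spaces.linear scale scale f" "bij f" "Q (f u) = Q u" "\<beta> (f u) (f v) = \<beta> u v"
    "f (u + v) = f u + f v" "f (u - v) = f u - f v" "f (scale c u) = scale c (f u)" "f 0 = 0"
proof -
  show *: "Vector_Spaces.linear scale scale f" "bij f" and iso: "\<And>u. Q (f u) = Q u"
    using assms by (auto simp: orthogonal_group_def)
  interpret Vector_Spaces.linear scale scale f by (rule *)
  show "f (u + v) = f u + f v" "f (u - v) = f u - f v" "f (scale c u) = scale c (f u)" "f 0 = 0"
    by (simp_all add: add diff scale zero)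
  then show "\<beta> (f u) (f v) = \<beta> u v" by (simp add: polar_def iso flip: add)
qed

text \<open>A preserved polar form puts the kernel into the radical, so the map is injective, hence
  onto by finite dimension.\<close>

lemma OVI:
  assumes lin: "Vector_Spaces.linear scale scale f" and iso: "\<And>u. Q (f u) = Q u"
  shows "f \<in> OV"
proof -
  interpret Vector_Spaces.linear scale scale f by (rule lin)
  have "\<beta> (f u) (f v) = \<beta> u v" for u v by (simp add: polar_def iso flip: add)
  then have "u = 0" if "f u = 0" for u
    using that polar_eq_0D[of u] polar_simps(7) by metis
  then have "inj f" by (simp add: inj_iff_eq_0)
  then have "bij f" using linear_inj_imp_surj[OF lin] by (simp add: bij_def)
  then show ?thesis using lin iso by (simp add: orthogonal_group_def)
qed

lemma id_OV: "id \<in> OV"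
  by (rule OVI) (simp_all add: linear_id)

lemma comp_OV: "f \<in> OV \<Longrightarrow> g \<in> OV \<Longrightarrow> f \<circ> g \<in> OV"
  by (rule OVI) (auto simp: Vector_Spaces.linear_iff OVD vector_space_axioms)

lemma inv_OV:
  assumes "f \<in> OV"
  shows "inv f \<in> OV"
proof (rule OVI)
  have inj: "inj f" and surj: "surj f" using OVD(2)[OF assms] by (auto simp: bij_def)
  show "Vector_Spaces.linear scale scale (inv f)"
    using inj_linear_imp_inv_linear[OF OVD(1)[OF assms] inj] .
  show "Q (inv f u) = Q u" for u
    using OVD(3)[OF assms, of "inv f u"] surj_f_inv_f[OF surj] by simp
qed

lemma comp_inv_comp: "g \<in> OV \<Longrightarrow> g \<circ> (inv g \<circ> f) = f"
  by (simp add: fun_eq_iff OVD(2) bij_is_surj surj_f_inv_f)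

section \<open>Moved spaces\<close>

lemma subspace_Mov:
  assumes "f \<in> OV"
  shows "subspace (Mov f)"
proof -
  have "Vector_Spaces.linear scale scale (\<lambda>v. v - f v)"
    by (auto simp: Vector_Spaces.linear_iff OVD[OF assms] vector_space_axioms scale_right_diff_distrib)
  then interpret Vector_Spaces.linear scale scale "\<lambda>v. v - f v" .
  show ?thesis unfolding Mov_def by (rule subspace_image) simp
qed

lemma Mov_subset_0_iff: "Mov f \<subseteq> {0} \<longleftrightarrow> f = id"
  by (auto simp: Mov_def fun_eq_iff image_subset_iff)

lemma Mov_memI: "v - f v \<in> Mov f"
  by (simp add: Mov_def)

lemma MovE:
  assumes "u \<in> Mov f"
  obtains w where "u = w - f w"
  using assms by (auto simp: Mov_def)

lemma Mov_comp_subset: "Mov (g \<circ> h) \<subseteq> {x + y |x y. x \<in> Mov g \<and> y \<in> Mov h}"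
proof
  fix z assume "z \<in> Mov (g \<circ> h)"
  then obtain w where "z = w - g (h w)" by (auto simp: Mov_def)
  then have "z = (h w - g (h w)) + (w - h w)" by simp
  then show "z \<in> {x + y |x y. x \<in> Mov g \<and> y \<in> Mov h}" using Mov_memI by blast
qed

section \<open>The Wall form\<close>

lemma wall_form_diff: "f \<in> OV \<Longrightarrow> v \<in> Mov f \<Longrightarrow> wall_form Q f (w - f w) v = \<beta> w v"
  by (rule wall_form_eq[OF quadratic]) auto

text \<open>\<open>wall_form\<close> picks a preimage separately for each first argument. A linear
  section \<open>s\<close> of the map sending \<open>v\<close> to \<open>v - f v\<close> yields a
  form that is bilinear on the whole space and can replace it in computations.\<close>

lemma wall_form_bilinear:
  assumes f: "f \<in> OV"
  obtains b where "bilinear_form scale b"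
    "\<And>u v. u \<in> Mov f \<Longrightarrow> v \<in> Mov f \<Longrightarrow> wall_form Q f u v = b u v"
proof -
  interpret P: vector_space_pair scale scale by unfold_locales
  have "Vector_Spaces.linear scale scale (\<lambda>v. v - f v)"
    by (auto simp: Vector_Spaces.linear_iff OVD[OF f] vector_space_axioms scale_right_diff_distrib)
  from P.linear_exists_right_inverse_on[OF this subspace_UNIV]
  obtain s where s: "Vector_Spaces.linear scale scale s" "\<forall>v\<in>Mov f. s v - f (s v) = v"
    by (auto simp: Mov_def)
  interpret s: Vector_Spaces.linear scale scale s by (rule s)
  have "bilinear_form scale (\<lambda>u. \<beta> (s u))"
    using bilinear_polar
    by (auto simp: bilinear_form_def Vector_Spaces.linear_iff s.add s.scale)
  moreover have "wall_form Q f u v = \<beta> (s u) v" if "u \<in> Mov f" "v \<in> Mov f" for u v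
    using wall_form_diff[OF f that(2), of "s u"] s(2) that(1) by simp
  ultimately show ?thesis using that by blast
qed

text \<open>For \<open>u = w - f w\<close>, expand \<open>Q w = Q (f w) = Q (w - u)\<close>. Hence
  the singular vectors of \<open>Mov f\<close> are the isotropic ones of the Wall form.\<close>

lemma wall_form_self:
  assumes f: "f \<in> OV" and u: "u \<in> Mov f"
  shows "wall_form Q f u u = Q u"
proof -
  obtain w where w: "u = w - f w" using u by (blast elim: MovE)
  then have "f w = w - u" by simp
  then have "Q w = Q (w - u)" using OVD(3)[OF f] by metis
  then have "\<beta> w u = Q u" by (simp add: Q_diff)
  then show ?thesis using wall_form_diff[OF f u] w by simp
qed

text \<open>The polarization of \<open>wall_form_self\<close>.\<close>

lemma wall_form_sym_sum:
  assumes f: "f \<in> OV" and "u \<in> Mov f" "v \<in> Mov f"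
  shows "wall_form Q f u v + wall_form Q f v u = \<beta> u v"
proof -
  obtain b where b: "bilinear_form scale b"
    "\<And>u v. u \<in> Mov f \<Longrightarrow> v \<in> Mov f \<Longrightarrow> wall_form Q f u v = b u v"
    using wall_form_bilinear[OF f] by blast
  note bs = bilinear_form_simps[OF b(1)]
  have "u + v \<in> Mov f" using assms subspace_add subspace_Mov by blast
  then have "b (u + v) (u + v) = Q (u + v)" "b u u = Q u" "b v v = Q v"
    using wall_form_self[OF f] assms b(2) by metis+
  then show ?thesis using assms by (simp add: b(2) bs Q_add algebra_simps)
qed

lemma wall_form_nondegenerate:
  assumes f: "f \<in> OV"
  shows "nondegenerate_on (Mov f) (wall_form Q f)"
  unfolding nondegenerate_on_def
proof (intro conjI ballI impI)
  fix v assume v: "v \<in> Mov f" "\<forall>u\<in>Mov f. wall_form Q f u v = 0"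
  then have "\<beta> w v = 0" for w using wall_form_diff[OF f v(1)] Mov_memI by metis
  then show "v = 0" using polar_eq_0D polar_commute by metis
next
  fix u assume u: "u \<in> Mov f" "\<forall>v\<in>Mov f. wall_form Q f u v = 0"
  obtain w where w: "u = w - f w" using u by (blast elim: MovE)
  have "\<beta> w (x - f x) = 0" for x using wall_form_diff[OF f Mov_memI] u(2) w Mov_memI by metis
  \<comment> \<open>Since \<open>\<beta> w x = \<beta> (f w) (f x)\<close>, the previous line says
    that \<open>u\<close> is orthogonal to the range of \<open>f\<close>, which is
    everything.\<close>
  then have "\<beta> u (f x) = 0" for x
    by (simp add: w polar_simps OVD(4)[OF f])
  then have "\<beta> u y = 0" for y using OVD(2)[OF f] by (metis bij_pointE)
  then show "u = 0" by (rule polar_eq_0D)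
qed

section \<open>Isometries and the data of moved space and Wall form\<close>

lemma Mov_inject:
  assumes f: "f \<in> OV" and g: "g \<in> OV" and eq: "Mov f = Mov g"
    and wall: "\<And>u v. u \<in> Mov f \<Longrightarrow> v \<in> Mov f \<Longrightarrow> wall_form Q f u v = wall_form Q g u v"
  shows "f = g"
proof
  fix x
  obtain b where b: "bilinear_form scale b"
    "\<And>u v. u \<in> Mov f \<Longrightarrow> v \<in> Mov f \<Longrightarrow> wall_form Q f u v = b u v"
    using wall_form_bilinear[OF f] by blast
  note bs = bilinear_form_simps[OF b(1)]
  have mem: "x - f x \<in> Mov f" "x - g x \<in> Mov f" using Mov_memI eq by auto
  have "b (x - f x) v = b (x - g x) v" if "v \<in> Mov f" for v
    using wall_form_diff[OF f, of v x] wall_form_diff[OF g, of v x] wall mem b(2) that eq by simp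
  then have "b ((x - f x) - (x - g x)) v = 0" if "v \<in> Mov f" for v
    using that by (simp only: bs(3)) simp
  moreover have m: "(x - f x) - (x - g x) \<in> Mov f"
    using mem subspace_diff subspace_Mov[OF f] by blast
  ultimately have "(x - f x) - (x - g x) = 0"
    using wall_form_nondegenerate[OF f] b(2) unfolding nondegenerate_on_def by metis
  then show "f x = g x" by simp
qed

lemma exists_isometry_with_Mov:
  assumes f: "f \<in> OV" and U: "subspace U" "U \<subseteq> Mov f"
    and nondeg: "nondegenerate_on U (wall_form Q f)"
  shows "\<exists>g\<in>OV. Mov g = U \<and> (\<forall>u\<in>U. \<forall>v\<in>U. wall_form Q f u v = wall_form Q g u v)"
proof -
  obtain b where b: "bilinear_form scale b"
    "\<And>u v. u \<in> Mov f \<Longrightarrow> v \<in> Mov f \<Longrightarrow> wall_form Q f u v = b u v"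
    using wall_form_bilinear[OF f] by blast
  note bs = bilinear_form_simps[OF b(1)]
  have nd: "u = 0" if "u \<in> U" "\<And>v. v \<in> U \<Longrightarrow> b u v = 0" for u
    using nondeg that b(2) U(2) unfolding nondegenerate_on_def by (metis subsetD)
  have uniq: "u = u'" if "u \<in> U" "u' \<in> U" "\<And>v. v \<in> U \<Longrightarrow> b u v = b u' v" for u u'
    using nd[of "u - u'"] that by (simp add: bs subspace_diff[OF U(1)])
  have "\<exists>u\<in>U. \<forall>v\<in>U. b u v = \<beta> x v" for x
    using bilinear_polar by (intro bilinear_form_represents b U nd) (auto simp: bilinear_form_def)
  then obtain p where p: "\<And>x. p x \<in> U" "\<And>x v. v \<in> U \<Longrightarrow> b (p x) v = \<beta> x v" by metis
  define g where "g x = x - p x" for x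
  have padd: "p (x + y) = p x + p y" for x y
    by (rule uniq) (simp_all add: p bs polar_simps subspace_add[OF U(1)])
  have pscale: "p (scale c x) = scale c (p x)" for c x
    by (rule uniq) (simp_all add: p bs polar_simps subspace_scale[OF U(1)])
  have "Vector_Spaces.linear scale scale g"
    by (simp add: Vector_Spaces.linear_iff vector_space_axioms g_def padd pscale scale_right_diff_distrib)
  \<comment> \<open>\<open>p x\<close> pairs with itself to \<open>\<beta> x (p x)\<close> by
    construction and to \<open>Q (p x)\<close> by \<open>wall_form_self\<close>, so these terms
    cancel in \<open>Q (x - p x)\<close>.\<close>
  moreover have "Q (g x) = Q x" for x
  proof -
    have "\<beta> x (p x) = Q (p x)"
      using p U(2) b(2) wall_form_self[OF f] by (metis subsetD)
    then show ?thesis by (simp add: g_def Q_diff)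
  qed
  ultimately have g: "g \<in> OV" by (rule OVI)
  have "u \<in> Mov g" if "u \<in> U" for u
  proof -
    obtain w where w: "u = w - f w" using U(2) \<open>u \<in> U\<close> by (blast elim: MovE)
    \<comment> \<open>\<open>u\<close> itself represents \<open>\<beta> w\<close> on
      \<open>U\<close>, hence is \<open>p w\<close>.\<close>
    have "b u v = \<beta> w v" if "v \<in> U" for v
      using wall_form_diff[OF f, of v w] that U(2) \<open>u \<in> U\<close> b(2)[of u v] w by (simp add: subset_iff)
    then have "p w = u" using that by (intro uniq) (simp_all add: p)
    then show ?thesis using Mov_memI[of w g] by (simp add: g_def)
  qed
  then have Mov: "Mov g = U" using p(1) by (auto simp: Mov_def g_def)
  have "wall_form Q f u v = wall_form Q g u v" if "u \<in> U" "v \<in> U" for u v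
  proof -
    obtain w where w: "u = w - g w" using Mov \<open>u \<in> U\<close> by (blast elim: MovE)
    then have "b u v = \<beta> w v" using p(2) \<open>v \<in> U\<close> by (simp add: g_def)
    then show ?thesis using wall_form_diff[OF g, of v w] Mov w that U(2) b(2)[of u v]
      by (simp add: subset_iff)
  qed
  then show ?thesis using g Mov by blast
qed

section \<open>Factorizations with complementary moved spaces\<close>

lemma Mov_inv_comp:
  assumes f: "f \<in> OV" and g: "g \<in> OV" and sub: "Mov g \<subseteq> Mov f"
    and wall: "\<And>u v. u \<in> Mov g \<Longrightarrow> v \<in> Mov g \<Longrightarrow> wall_form Q f u v = wall_form Q g u v"
  shows "Mov (inv g \<circ> f) = wall_orth Q f (Mov g)"
    and "dim (Mov f) = dim (Mov g) + dim (Mov (inv g \<circ> f))"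
proof -
  let ?h = "inv g \<circ> f"
  note sf = subspace_Mov[OF f] and sg = subspace_Mov[OF g]
  have h: "?h \<in> OV" using comp_OV inv_OV f g by blast
  obtain b where b: "bilinear_form scale b"
    "\<And>u v. u \<in> Mov f \<Longrightarrow> v \<in> Mov f \<Longrightarrow> wall_form Q f u v = b u v"
    using wall_form_bilinear[OF f] by blast
  note bs = bilinear_form_simps[OF b(1)]
  have orth: "d \<in> wall_orth Q f (Mov g)" if "d \<in> Mov ?h" for d
  proof -
    obtain x where x: "d = x - ?h x" using \<open>d \<in> Mov ?h\<close> by (rule MovE)
    define y where "y = ?h x"
    have gy: "g y = f x" using comp_inv_comp[OF g, of f] by (metis comp_apply y_def)
    \<comment> \<open>Because \<open>g y = f x\<close>, a displacement of \<open>?h\<close> is a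
      difference of displacements of \<open>f\<close> and \<open>g\<close>.\<close>
    have dec: "d = (x - f x) - (y - g y)" using x gy y_def by simp
    have d: "d \<in> Mov f" using dec sub Mov_memI subspace_diff[OF sf] by (metis subsetD)
    have "wall_form Q f v d = 0" if v: "v \<in> Mov g" for v
    proof -
      have vf: "v \<in> Mov f" and yf: "y - g y \<in> Mov f" using v sub Mov_memI by auto
      have "b (x - f x) v = \<beta> x v"
        using wall_form_diff[OF f vf] b(2) vf Mov_memI by metis
      moreover have "b (y - g y) v = \<beta> y v"
        using wall_form_diff[OF g v] b(2)[OF yf vf] wall v Mov_memI by metis
      ultimately have "b d v = \<beta> x v - \<beta> y v" by (simp only: dec bs(3))
      \<comment> \<open>As \<open>d = x - y\<close>, this order of arguments already accounts for
        all of the symmetrized value \<open>\<beta> d v\<close>, leaving 0 for the reversed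
        order.\<close>
      then have "wall_form Q f d v = \<beta> d v" using b(2) d vf x y_def by (simp add: polar_simps)
      then show ?thesis using wall_form_sym_sum[OF f d vf] by simp
    qed
    then show ?thesis using d by (simp add: wall_orth_def)
  qed
  have disj: "v = 0" if "v \<in> Mov g" "v \<in> wall_orth Q f (Mov g)" for v
    using that wall wall_form_nondegenerate[OF g]
    by (auto simp: wall_orth_def nondegenerate_on_def)
  have sums: "\<exists>x\<in>Mov g. \<exists>y\<in>Mov ?h. z = x + y" if "z \<in> Mov f" for z
    using Mov_comp_subset[of g ?h, unfolded comp_inv_comp[OF g]] that by blast
  \<comment> \<open>Split \<open>z\<close> along \<open>Mov g\<close> and \<open>Mov ?h\<close>; the
    part in \<open>Mov g\<close> is also orthogonal to \<open>Mov g\<close>, so it vanishes by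
    \<open>disj\<close>.\<close>
  have orth_sub: "z \<in> Mov ?h" if z: "z \<in> wall_orth Q f (Mov g)" for z
  proof -
    obtain x y where xy: "x \<in> Mov g" "y \<in> Mov ?h" "z = x + y"
      using sums[of z] z unfolding wall_orth_def by blast
    have y: "y \<in> wall_orth Q f (Mov g)" using orth xy by blast
    have "wall_form Q f u x = 0" if "u \<in> Mov g" for u
    proof -
      have m: "u \<in> Mov f" "x \<in> Mov f" "y \<in> Mov f" "z \<in> Mov f"
        using sub that xy y z by (auto simp: wall_orth_def)
      moreover have "wall_form Q f u z = 0" "wall_form Q f u y = 0"
        using y z that by (auto simp: wall_orth_def)
      ultimately have "b u (x + y) = 0" "b u y = 0" using b(2) xy(3) by metis+
      then show ?thesis using b(2) m by (simp add: bs)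
    qed
    then have "x \<in> wall_orth Q f (Mov g)" using xy sub by (auto simp: wall_orth_def)
    then have "x = 0" using disj xy by blast
    then show ?thesis using xy by simp
  qed
  show eq: "Mov ?h = wall_orth Q f (Mov g)" using orth orth_sub by blast
  have "Mov f = {x + y |x y. x \<in> Mov g \<and> y \<in> Mov ?h}"
  proof
    show "{x + y |x y. x \<in> Mov g \<and> y \<in> Mov ?h} \<subseteq> Mov f"
      using sub orth by (auto simp: wall_orth_def intro!: subspace_add[OF sf])
  qed (use sums in blast)
  moreover have "Mov g \<inter> Mov ?h = {0}"
    using disj orth subspace_0 sg subspace_Mov[OF h] by blast
  ultimately show "dim (Mov f) = dim (Mov g) + dim (Mov ?h)"
    using dim_sums_Int[OF sg subspace_Mov[OF h]] by (simp add: dim_eq_0)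
qed

text \<open>A converse to \<open>Mov_inv_comp\<close>: \<open>Mov f\<close> lies in the sum of the
  two moved spaces, and the dimension bound forces equality and a trivial intersection.\<close>

lemma Mov_inv_comp_dim:
  assumes f: "f \<in> OV" and g: "g \<in> OV"
    and le: "dim (Mov g) + dim (Mov (inv g \<circ> f)) \<le> dim (Mov f)"
  shows "Mov g \<subseteq> Mov f"
    and "\<And>u v. u \<in> Mov g \<Longrightarrow> v \<in> Mov g \<Longrightarrow> wall_form Q f u v = wall_form Q g u v"
proof -
  let ?h = "inv g \<circ> f"
  let ?S = "{x + y |x y. x \<in> Mov g \<and> y \<in> Mov ?h}"
  have h: "?h \<in> OV" using comp_OV inv_OV f g by blast
  note sg = subspace_Mov[OF g] and sh = subspace_Mov[OF h]
  have sum: "Mov f \<subseteq> ?S" using Mov_comp_subset[of g ?h, unfolded comp_inv_comp[OF g]] .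
  note dims = dim_sums_Int[OF sg sh]
  have "Mov f = ?S"
    using subspace_dim_equal[OF subspace_Mov[OF f] subspace_sums[OF sg sh] sum] dims le by simp
  moreover have "x + 0 \<in> ?S" if "x \<in> Mov g" for x using that subspace_0[OF sh] by blast
  ultimately show sub: "Mov g \<subseteq> Mov f" by auto
  have "dim (Mov g \<inter> Mov ?h) = 0" using dims le dim_subset[OF sum] by linarith
  then have int: "x = 0" if "x \<in> Mov g" "x \<in> Mov ?h" for x using that by auto
  show "wall_form Q f u v = wall_form Q g u v" if u: "u \<in> Mov g" and v: "v \<in> Mov g" for u v
  proof -
    obtain w where w: "u = w - f w" using u sub by (blast elim: MovE)
    have gh: "g (?h w) = f w" using comp_inv_comp[OF g, of f] by (metis comp_apply)
    \<comment> \<open>\<open>w - ?h w\<close> lies in both moved spaces, so \<open>?h\<close> fixes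
      \<open>w\<close>; then \<open>f w = g w\<close>, and one preimage serves both Wall
      forms.\<close>
    have "w - ?h w = u - (?h w - g (?h w))" using w gh by simp
    then have "w - ?h w \<in> Mov g" using u Mov_memI subspace_diff[OF sg] by metis
    then have "?h w = w" using int[OF _ Mov_memI[of w ?h]] by simp
    then have "u = w - g w" using w gh by simp
    then show ?thesis
      using w wall_form_diff[OF f, of v w] wall_form_diff[OF g v, of w] sub v by auto
  qed
qed

section \<open>Reflections and products of them\<close>

lemma reflect_OV:
  assumes "Q v \<noteq> 0"
  shows "reflect v \<in> OV"
proof (rule OVI)
  show "Vector_Spaces.linear scale scale (reflect v)"
    by (auto simp: Vector_Spaces.linear_iff vector_space_axioms reflection_def polar_simps add_divide_distrib
        scale_left_distrib scale_right_diff_distrib)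
  show "Q (reflect v u) = Q u" for u
    using assms by (simp add: reflection_def Q_diff Q_scale polar_simps power2_eq_square)
qed

lemma reflect_reflect: "Q v \<noteq> 0 \<Longrightarrow> reflect v (reflect v u) = u"
  by (simp add: reflection_def polar_simps polar_self diff_divide_distrib scale_left_diff_distrib
      flip: scale_left_distrib)

lemma inv_reflect: "Q v \<noteq> 0 \<Longrightarrow> inv (reflect v) = reflect v"
  using reflect_reflect by (intro inv_equality) auto

lemma Mov_reflect:
  assumes v: "Q v \<noteq> 0"
  shows "Mov (reflect v) = span {v}"
proof
  show "Mov (reflect v) \<subseteq> span {v}"
    by (auto simp: Mov_def reflection_def span_singleton)
  have "v \<noteq> 0" using v Q_0 by auto
  then obtain x where x: "\<beta> x v \<noteq> 0" using polar_eq_0D polar_commute by metis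
  have "scale c v \<in> Mov (reflect v)" for c
    using Mov_memI[of "scale (c * Q v / \<beta> x v) x" "reflect v"] x v
    by (simp add: reflection_def polar_simps)
  then show "span {v} \<subseteq> Mov (reflect v)" by (auto simp: span_singleton)
qed

lemma Mov_reflections_product: "\<forall>v\<in>set vs. Q v \<noteq> 0 \<Longrightarrow> Mov (reflections_product vs) \<subseteq> span (set vs)"
proof (induction vs)
  case Nil
  then show ?case by (simp add: Mov_def)
next
  case (Cons v vs)
  have "Mov (reflect v) \<subseteq> span (set (v # vs))"
    using Mov_reflect[of v] Cons.prems span_mono[of "{v}" "set (v # vs)"] by simp
  moreover have "Mov (reflections_product vs) \<subseteq> span (set vs)"
    by (rule Cons.IH) (use Cons.prems in simp)
  then have "Mov (reflections_product vs) \<subseteq> span (set (v # vs))"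
    using span_mono[OF set_subset_Cons] by (rule subset_trans)
  moreover have "Mov (reflections_product (v # vs))
      \<subseteq> {x + y |x y. x \<in> Mov (reflect v) \<and> y \<in> Mov (reflections_product vs)}"
    using Mov_comp_subset[of "reflect v" "reflections_product vs"] by simp
  ultimately show ?case
    using span_add[of _ "set (v # vs)"] by (fastforce simp del: foldr.simps list.map list.set)
qed

lemma dim_Mov_reflections_product_le:
  assumes "\<forall>v\<in>set vs. Q v \<noteq> 0"
  shows "dim (Mov (reflections_product vs)) \<le> length vs"
  using dim_le_card[OF Mov_reflections_product[OF assms]] card_length[of vs] by simp

text \<open>Induction on \<open>dim (Mov f)\<close>: composing with the reflection along a suitable
  \<open>v\<close> cuts the moved space down to the Wall-orthogonal hyperplane of \<open>v\<close>,
  and \<open>v\<close> is chosen so that the hypothesis survives.\<close>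

lemma factor_minimal:
  assumes card: "card (UNIV :: 'k set) \<noteq> 2"
    and "f \<in> OV" and "Mov f = {0} \<or> \<not> totally_singular Q (Mov f)"
  shows "\<exists>vs. length vs = dim (Mov f) \<and> (\<forall>v\<in>set vs. Q v \<noteq> 0) \<and> f = reflections_product vs"
  using assms(2,3)
proof (induction "dim (Mov f)" arbitrary: f rule: less_induct)
  case less
  note f = less.prems(1)
  show ?case
  proof (cases "Mov f = {0}")
    case True
    then have "f = id" using Mov_subset_0_iff[of f] by simp
    then show ?thesis using True by (intro exI[of _ "[]"]) simp
  next
    case False
    then obtain v0 where v0: "v0 \<in> Mov f" "Q v0 \<noteq> 0"
      using less.prems(2) by (auto simp: totally_singular_def)
    obtain b where b: "bilinear_form scale b"
      "\<And>u v. u \<in> Mov f \<Longrightarrow> v \<in> Mov f \<Longrightarrow> wall_form Q f u v = b u v"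
      using wall_form_bilinear[OF f] by blast
    note bs = bilinear_form_simps[OF b(1)]
    have bQ: "b u u = Q u" if "u \<in> Mov f" for u using wall_form_self[OF f that] b(2) that by simp
    have nd: "v = 0" if "v \<in> Mov f" "\<And>u. u \<in> Mov f \<Longrightarrow> b u v = 0" for v
      using wall_form_nondegenerate[OF f] that b(2) unfolding nondegenerate_on_def by metis
    obtain v where v: "v \<in> Mov f" "b v v \<noteq> 0"
      and comp: "{u \<in> Mov f. b v u = 0} = {0} \<or> (\<exists>u\<in>Mov f. b v u = 0 \<and> b u u \<noteq> 0)"
      using exists_anisotropic_with_good_complement
        [OF card b(1) subspace_Mov[OF f] nd v0(1)] bQ v0 by metis
    have Qv: "Q v \<noteq> 0" using v bQ by simp
    note g = reflect_OV[OF Qv]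
    let ?h = "reflect v \<circ> f"
    have sub: "Mov (reflect v) \<subseteq> Mov f"
      unfolding Mov_reflect[OF Qv] using v subspace_Mov[OF f] by (intro span_minimal) auto
    \<comment> \<open>On the line through \<open>v\<close>, both forms are determined by their value
      \<open>Q v\<close> at \<open>v\<close>.\<close>
    have wall: "wall_form Q f u u' = wall_form Q (reflect v) u u'"
      if "u \<in> Mov (reflect v)" "u' \<in> Mov (reflect v)" for u u'
    proof -
      obtain w where w: "u = w - reflect v w" using \<open>u \<in> Mov (reflect v)\<close> by (rule MovE)
      then have u: "u = scale (\<beta> w v / Q v) v" by (simp add: reflection_def)
      obtain c where c: "u' = scale c v" using \<open>u' \<in> Mov (reflect v)\<close> Mov_reflect[OF Qv] by (auto simp: span_singleton)
      have "wall_form Q (reflect v) u u' = \<beta> w u'" using wall_form_diff[OF g that(2)] w by simp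
      moreover have "wall_form Q f u u' = b u u'" using b(2) that sub by blast
      ultimately show ?thesis using Qv bQ[OF v(1)] by (simp add: u c bs polar_simps)
    qed
    have "wall_orth Q f (Mov (reflect v)) = {u \<in> Mov f. b v u = 0}"
    proof -
      have "(\<forall>c. wall_form Q f (scale c v) u = 0) \<longleftrightarrow> b v u = 0" if "u \<in> Mov f" for u
        using that v subspace_scale[OF subspace_Mov[OF f]] b(2)
        by (auto simp: bs intro: allE[of _ 1])
      then show ?thesis by (auto simp: wall_orth_def Mov_reflect[OF Qv] span_singleton)
    qed
    with Mov_inv_comp[OF f g sub wall] have Movh: "Mov ?h = {u \<in> Mov f. b v u = 0}"
      and dim: "dim (Mov f) = dim (Mov (reflect v)) + dim (Mov ?h)"
      by (simp_all add: inv_reflect[OF Qv])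
    have "dim (Mov (reflect v)) = 1" using Qv Q_0 by (auto simp: Mov_reflect)
    with dim have dim1: "dim (Mov f) = Suc (dim (Mov ?h))" by simp
    have "Mov ?h = {0} \<or> \<not> totally_singular Q (Mov ?h)"
      using comp bQ unfolding Movh totally_singular_def by auto
    then obtain vs where vs: "length vs = dim (Mov ?h)" "\<forall>v\<in>set vs. Q v \<noteq> 0"
      "?h = reflections_product vs"
      using less.hyps[of ?h] dim1 comp_OV[OF g f] by auto
    have "f = reflect v \<circ> ?h" by (simp add: fun_eq_iff reflect_reflect[OF Qv])
    then show ?thesis using vs dim1 Qv by (intro exI[of _ "v # vs"]) simp
  qed
qed

text \<open>This makes the \<open>LEAST\<close> in \<open>reflection_length\<close> range over a
  non-empty set. If \<open>Mov f\<close> is non-zero and totally singular, composing with one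
  reflection yields a case covered by \<open>factor_minimal\<close>.\<close>

lemma exists_factorization:
  assumes card: "card (UNIV :: 'k set) \<noteq> 2" and f: "f \<in> OV"
  shows "\<exists>vs. (\<forall>v\<in>set vs. Q v \<noteq> 0) \<and> f = reflections_product vs"
proof (cases "Mov f = {0} \<or> \<not> totally_singular Q (Mov f)")
  case True
  then show ?thesis using factor_minimal[OF card f] by blast
next
  case False
  then have sing: "Q (x - f x) = 0" for x using Mov_memI by (auto simp: totally_singular_def)
  have "\<not> Mov f \<subseteq> {0}" using False subspace_0[OF subspace_Mov[OF f]] by auto
  then obtain u :: 'v where u: "u \<noteq> 0" by blast
  obtain v where v: "Q v \<noteq> 0"
  proof -
    have "\<exists>v. Q v \<noteq> 0"
    proof (rule ccontr)
      assume "\<nexists>v. Q v \<noteq> 0"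
      then have "\<beta> u w = 0" for w by (simp add: polar_def)
      then show False using polar_eq_0D u by blast
    qed
    then show ?thesis using that by blast
  qed
  have "v \<noteq> 0" using v Q_0 by auto
  then obtain y where y: "\<beta> y v \<noteq> 0" using polar_eq_0D polar_commute by metis
  obtain z where z: "\<beta> (f z) v \<noteq> 0" using y OVD(2)[OF f] by (metis bij_pointE)
  obtain x where x: "\<beta> x v \<noteq> 0" "\<beta> (f x) v \<noteq> 0"
    \<comment> \<open>a vector space is not the union of two proper subspaces\<close>
  proof -
    have "\<beta> (y + z) v \<noteq> 0 \<and> \<beta> (f (y + z)) v \<noteq> 0" if "\<beta> (f y) v = 0" "\<beta> z v = 0"
      using that y z by (simp add: OVD(5)[OF f] polar_simps)
    then show ?thesis using that y z by blast
  qed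
  let ?h = "reflect v \<circ> f"
  have h: "?h \<in> OV" using comp_OV reflect_OV[OF v] f by blast
  \<comment> \<open>The value turns out to be \<open>\<beta> x v * \<beta> (f x) v / Q v\<close>,
    which is why both factors were made non-zero.\<close>
  have "Q (x - ?h x) = Q ((x - f x) + scale (\<beta> (f x) v / Q v) v)"
    by (simp add: reflection_def algebra_simps)
  also have "\<dots> = (\<beta> (f x) v / Q v)\<^sup>2 * Q v + \<beta> (f x) v / Q v * (\<beta> x v - \<beta> (f x) v)"
    by (simp only: Q_add[of "x - f x"] sing Q_scale polar_simps add_0)
  also have "\<dots> = \<beta> x v * \<beta> (f x) v / Q v"
    using v by (simp add: power2_eq_square field_simps)
  finally have "Q (x - ?h x) \<noteq> 0" using x v by simp
  then have "\<not> totally_singular Q (Mov ?h)"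
    using Mov_memI[of x ?h] unfolding totally_singular_def by blast
  then obtain vs where vs: "\<forall>v\<in>set vs. Q v \<noteq> 0" "?h = reflections_product vs"
    using factor_minimal[OF card h] by blast
  have "f = reflect v \<circ> ?h" by (simp add: fun_eq_iff reflect_reflect[OF v])
  then show ?thesis using vs v by (intro exI[of _ "v # vs"]) simp
qed

section \<open>Reflection length and the partial order\<close>

lemma len_le: "\<forall>v\<in>set vs. Q v \<noteq> 0 \<Longrightarrow> len (reflections_product vs) \<le> length vs"
  unfolding reflection_length_def by (rule Least_le) blast

lemma len_id: "len id = 0"
  using len_le[of "[]"] by simp

lemma len_attained:
  assumes card: "card (UNIV :: 'k set) \<noteq> 2" and f: "f \<in> OV"
  shows "\<exists>vs. length vs = len f \<and> (\<forall>v\<in>set vs. Q v \<noteq> 0) \<and> f = reflections_product vs"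
proof -
  have "\<exists>n vs. length vs = n \<and> (\<forall>v\<in>set vs. Q v \<noteq> 0) \<and> f = reflections_product vs"
    using exists_factorization[OF assms] by blast
  then show ?thesis unfolding reflection_length_def by (rule LeastI_ex)
qed

lemma dim_Mov_le_len:
  assumes "card (UNIV :: 'k set) \<noteq> 2" and "f \<in> OV"
  shows "dim (Mov f) \<le> len f"
  using len_attained[OF assms] dim_Mov_reflections_product_le by metis

text \<open>If \<open>dim (Mov f)\<close> reflections suffice, their vectors span
  \<open>Mov f\<close>, which is thus zero or contains a non-singular vector. Conversely,
  \<open>factor_minimal\<close> attains the lower bound.\<close>

lemma minimal_iff:
  assumes card: "card (UNIV :: 'k set) \<noteq> 2" and f: "f \<in> OV"
  shows "len f = dim (Mov f) \<longleftrightarrow> Mov f = {0} \<or> \<not> totally_singular Q (Mov f)"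
proof
  assume eq: "len f = dim (Mov f)"
  obtain vs where vs: "length vs = len f" "\<forall>v\<in>set vs. Q v \<noteq> 0" "f = reflections_product vs"
    using len_attained[OF assms] by blast
  have sub: "Mov f \<subseteq> span (set vs)" using Mov_reflections_product vs by blast
  have "dim (span (set vs)) \<le> card (set vs)" by (rule dim_le_card) simp_all
  then have "dim (span (set vs)) \<le> dim (Mov f)" using card_length[of vs] vs(1) eq by linarith
  then have span: "Mov f = span (set vs)"
    using subspace_dim_equal[OF subspace_Mov[OF f] subspace_span sub] by simp
  show "Mov f = {0} \<or> \<not> totally_singular Q (Mov f)"
  proof (cases vs)
    case (Cons v ws)
    then have "v \<in> Mov f" "Q v \<noteq> 0" using vs span span_base[of v "set vs"] by auto
    then show ?thesis by (auto simp: totally_singular_def)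
  qed (use span in simp)
next
  assume "Mov f = {0} \<or> \<not> totally_singular Q (Mov f)"
  then obtain vs where vs: "length vs = dim (Mov f)" "\<forall>v\<in>set vs. Q v \<noteq> 0"
    "f = reflections_product vs"
    using factor_minimal[OF assms] by blast
  then have "len f \<le> dim (Mov f)" using len_le by metis
  then show "len f = dim (Mov f)" using dim_Mov_le_len[OF assms] by simp
qed

text \<open>The lengths add up to \<open>dim (Mov f)\<close> and each is at least the dimension of
  its moved space, so \<open>Mov_inv_comp_dim\<close> applies. Additivity of dimensions then turns
  both inequalities into equalities.\<close>

lemma isometry_leD:
  assumes card: "card (UNIV :: 'k set) \<noteq> 2" and f: "f \<in> OV" and g: "g \<in> OV"
    and min: "len f = dim (Mov f)" and le: "isometry_le scale Q g f"
  shows "len g = dim (Mov g)" "len (inv g \<circ> f) = dim (Mov (inv g \<circ> f))"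
    "Mov g \<subseteq> Mov f" "Mov (inv g \<circ> f) = wall_orth Q f (Mov g)"
    "\<And>u v. u \<in> Mov g \<Longrightarrow> v \<in> Mov g \<Longrightarrow> wall_form Q f u v = wall_form Q g u v"
proof -
  have h: "inv g \<circ> f \<in> OV" using comp_OV inv_OV f g by blast
  have len: "len f = len g + len (inv g \<circ> f)" using le by (simp add: isometry_le_def)
  note ge = dim_Mov_le_len[OF card g] dim_Mov_le_len[OF card h]
  have "dim (Mov g) + dim (Mov (inv g \<circ> f)) \<le> dim (Mov f)" using len min ge by linarith
  note * = Mov_inv_comp_dim[OF f g this]
  show "Mov g \<subseteq> Mov f" by (rule *)
  show wall: "wall_form Q f u v = wall_form Q g u v" if "u \<in> Mov g" "v \<in> Mov g" for u v
    by (rule *) (fact that)+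
  note ** = Mov_inv_comp[OF f g *(1) wall]
  show "Mov (inv g \<circ> f) = wall_orth Q f (Mov g)" by (rule **)
  show "len g = dim (Mov g)" "len (inv g \<circ> f) = dim (Mov (inv g \<circ> f))"
    using **(2) len min ge by linarith+
qed

text \<open>\<open>id\<close> has length 0, so it lies below everything.\<close>

lemma isometry_interval_eq:
  "isometry_interval scale Q f = {g \<in> OV. isometry_le scale Q g f}"
  by (auto simp: isometry_interval_def isometry_le_def len_id)

end

theorem theorem3p5:
  fixes scale :: "'k::field \<Rightarrow> 'v::ab_group_add \<Rightarrow> 'v"
    and Basis :: "'v set"
    and Q :: "'v \<Rightarrow> 'k"
    and f :: "'v \<Rightarrow> 'v"
  assumes "card (UNIV :: 'k set) \<noteq> 2"
    and "finite_dimensional_vector_space scale Basis"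
    and "quadratic_form scale Q"
    and "nondegenerate_on UNIV (polar Q)"
    and "minimal_isometry scale Q f"
  shows "bij_betw Mov (isometry_interval scale Q f)
           {U. module.subspace scale U \<and> U \<subseteq> Mov f \<and>
               (U = {0} \<or> \<not> totally_singular Q U) \<and>
               (wall_orth Q f U = {0} \<or> \<not> totally_singular Q (wall_orth Q f U)) \<and>
               nondegenerate_on U (wall_form Q f)}
       \<and> monotone_on (isometry_interval scale Q f) (isometry_le scale Q) (\<subseteq>) Mov
       \<and> (\<forall>g \<in> isometry_interval scale Q f.
            reflection_length scale Q g = vector_space.dim scale (Mov g))"
proof -
  interpret finite_dimensional_vector_space scale Basis by fact
  interpret quadratic_space scale Basis Q by unfold_locales fact+
  note card = assms(1)
  have f: "f \<in> OV" and min: "len f = dim (Mov f)"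
    using assms(5) by (auto simp: minimal_isometry_def)
  note leD = isometry_leD[OF card f _ min]
  let ?\<U> = "{U. subspace U \<and> U \<subseteq> Mov f \<and> (U = {0} \<or> \<not> totally_singular Q U) \<and>
               (wall_orth Q f U = {0} \<or> \<not> totally_singular Q (wall_orth Q f U)) \<and>
               nondegenerate_on U (wall_form Q f)}"
  have inj: "inj_on Mov {g \<in> OV. isometry_le scale Q g f}"
  proof (rule inj_onI, clarify)
    fix g g' assume g: "g \<in> OV" "isometry_le scale Q g f"
      and g': "g' \<in> OV" "isometry_le scale Q g' f" and eq: "Mov g = Mov g'"
    \<comment> \<open>Both Wall forms are restrictions of that of \<open>f\<close>, so they agree on
      the common moved space.\<close>
    show "g = g'"
      using leD(5)[OF g] leD(5)[OF g'] eq by (intro Mov_inject g g' eq) metis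
  qed
  \<comment> \<open>By \<open>minimal_iff\<close>, the two singularity conditions express the
    minimality of \<open>g\<close> and of \<open>inv g \<circ> f\<close>.\<close>
  have into: "Mov g \<in> ?\<U>" if g: "g \<in> OV" "isometry_le scale Q g f" for g
  proof -
    have h: "inv g \<circ> f \<in> OV" using comp_OV inv_OV f g by blast
    have "nondegenerate_on (Mov g) (wall_form Q f)"
      using wall_form_nondegenerate[OF g(1)] leD(5)[OF g] by (simp add: nondegenerate_on_def)
    then show ?thesis
      using leD(1-4)[OF g] minimal_iff[OF card g(1)] minimal_iff[OF card h] subspace_Mov[OF g(1)]
      by simp
  qed
  have onto: "U \<in> Mov ` {g \<in> OV. isometry_le scale Q g f}" if U: "U \<in> ?\<U>" for U
  proof -
    have sub: "U \<subseteq> Mov f" and "subspace U" "nondegenerate_on U (wall_form Q f)" using U by simp_all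
    then obtain g where g: "g \<in> OV" "Mov g = U"
      "\<forall>u\<in>U. \<forall>v\<in>U. wall_form Q f u v = wall_form Q g u v"
      using exists_isometry_with_Mov[OF f] by metis
    have h: "inv g \<circ> f \<in> OV" using comp_OV inv_OV f g by blast
    have Mov: "Mov (inv g \<circ> f) = wall_orth Q f (Mov g)"
      and dim: "dim (Mov f) = dim (Mov g) + dim (Mov (inv g \<circ> f))"
      using Mov_inv_comp[OF f g(1)] sub g(2,3) by simp_all
    \<comment> \<open>With both factors minimal, additivity of dimensions becomes additivity of
      lengths.\<close>
    have "len g = dim (Mov g)" "len (inv g \<circ> f) = dim (Mov (inv g \<circ> f))"
      using minimal_iff[OF card g(1)] minimal_iff[OF card h] U g(2) Mov by simp_all
    then have "isometry_le scale Q g f" using dim min by (simp add: isometry_le_def)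
    then show ?thesis using g by blast
  qed
  have "bij_betw Mov {g \<in> OV. isometry_le scale Q g f} ?\<U>"
    by (rule bij_betw_imageI[OF inj], rule subset_antisym; rule subsetI)
      (erule imageE, use into in simp, rule onto)
  \<comment> \<open>Elements of the interval are minimal, so \<open>isometry_leD\<close> applies
    with the larger one in the role of \<open>f\<close>.\<close>
  moreover have "monotone_on {g \<in> OV. isometry_le scale Q g f} (isometry_le scale Q) (\<subseteq>) Mov"
    using isometry_leD(3)[OF card] leD(1) by (auto simp: monotone_on_def)
  ultimately show ?thesis
    using leD(1) unfolding isometry_interval_eq by simp
qed

end
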